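(* Let $\mathcal{H}$ be a nonzero real Hilbert space, and let $C$ and $D$ be nonempty convex subsets of $\mathcal{H}$ with $C\neq\{0\}$ and $D\neq\{0\}$. Assume that $(x,y)$ is a pair of principal vectors of $C$ and $D$. Let $\lambda\in\mathbb{R}_{++}$. Then the following hold: (i) If $x\neq 0$, $y\neq 0$ and $|\langle x,y\rangle|\neq 1$, then $x+\operatorname{cone}(y-\langle x,y\rangle x)\subseteq(\overline{\operatorname{cone}}(C))^{c}$, $x\notin\operatorname{int}\overline{\operatorname{cone}}(C)$, $y+\operatorname{cone}(x-\langle x,y\rangle y)\subseteq(\overline{\operatorname{cone}}(D))^{c}$, and $y\notin\operatorname{int}\overline{\operatorname{cone}}(D)$. (ii) $x=P_{\overline{\operatorname{cone}}(C)}\big(x+\operatorname{cone}(y-\langle x,y\rangle x)\big)$ and $y=P_{\overline{\operatorname{cone}}(D)}\big(y+\operatorname{cone}(x-\langle x,y\rangle y)\big)$. (iii) $\lambda(y-\langle x,y\rangle x)=P_{C^{\ominus}}\big(x+\lambda(y-\langle x,y\rangle x)\big)$ and $\lambda(x-\langle x,y\rangle y)=P_{D^{\ominus}}\big(y+\lambda(x-\langle x,y\rangle y)\big)$.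
   Context: $\mathbb{R}_{++}=\{\lambda\in\mathbb{R}:\lambda>0\}$, $\mathbf{B}_{\mathcal{H}}=\{x\in\mathcal{H}:\|x\|\le 1\}$. A set $A\subseteq\mathcal{H}$ is a cone if $A=\mathbb{R}_{++}A$. $\operatorname{cone}(A)=\mathbb{R}_{++}A$ is the smallest cone containing $A$; in particular for a vector $v$, $\operatorname{cone}(v)=\{\mu v:\mu>0\}$. $\overline{\operatorname{cone}}(A)$ is the smallest closed cone containing $A$; for $A$ convex it equals the closure of $\operatorname{cone}(A)$. $A^{c}$ is the complement $\mathcal{H}\smallsetminus A$ and $\operatorname{int}$ denotes interior. The polar cone of $A$ is $A^{\ominus}=\{u\in\mathcal{H}:\langle z,u\rangle\le 0\ \text{for all } z\in A\}$. For a nonempty closed convex set $A$, $P_A$ is the projector (nearest-point map) onto $A$; an equality $x=P_A(S)$ with $S$ a set means $P_A s=x$ for every $s\in S$. For nonempty convex sets $C,D$, $(x,y)\in\mathcal{H}\times\mathcal{H}$ is a pair of principal vectors of $C$ and $D$ if $x\in\overline{\operatorname{cone}}(C)\cap\mathbf{B}_{\mathcal{H}}$, $y\in\overline{\operatorname{cone}}(D)\cap\mathbf{B}_{\mathcal{H}}$, and $$\langle x,y\rangle=\sup\{\langle a,b\rangle : a\in\overline{\operatorname{cone}}(C)\cap\mathbf{B}_{\mathcal{H}},\ b\in\overline{\operatorname{cone}}(D)\cap\mathbf{B}_{\mathcal{H}}\}.$$ *)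

theory Defs
  imports "HOL-Analysis.Analysis"
begin

text \<open>
  Cones are understood as sets invariant under multiplication by \<^emph>\<open>strictly\<close> positive scalars.
  They need not contain the origin, in contrast to the library predicate \<^const>\<open>cone\<close>,
  which is therefore not used here.
\<close>

definition pos_cone :: "'a::real_vector set \<Rightarrow> 'a set"
  where "pos_cone A = {\<mu> *\<^sub>R a | \<mu> a. \<mu> > 0 \<and> a \<in> A}"

definition is_pos_cone :: "'a::real_vector set \<Rightarrow> bool"
  where "is_pos_cone A \<longleftrightarrow> A = pos_cone A"

definition closed_pos_cone :: "'a::real_normed_vector set \<Rightarrow> 'a set"
  where "closed_pos_cone A = (\<lambda>S. closed S \<and> is_pos_cone S) hull A"

definition polar_cone :: "'a::real_inner set \<Rightarrow> 'a set"
  where "polar_cone A = {u. \<forall>z\<in>A. inner z u \<le> 0}"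

text \<open>
  The library constant \<^const>\<open>closest_point\<close> is restricted to spaces with the Heine-Borel
  property, which excludes infinite-dimensional Hilbert spaces. The description below denotes the
  nearest point whenever there is exactly one, in particular if \<open>A\<close> is a nonempty closed
  convex subset of a Hilbert space.
\<close>

definition projector :: "'a::real_inner set \<Rightarrow> 'a \<Rightarrow> 'a"
  where "projector A z = (THE p. p \<in> A \<and> (\<forall>a\<in>A. dist z p \<le> dist z a))"

definition principal_vectors :: "'a::real_inner set \<Rightarrow> 'a set \<Rightarrow> 'a \<Rightarrow> 'a \<Rightarrow> bool"
  where "principal_vectors C D x y \<longleftrightarrow>
    x \<in> closed_pos_cone C \<inter> cball 0 1 \<and>
    y \<in> closed_pos_cone D \<inter> cball 0 1 \<and>
    inner x y = Sup {inner a b | a b. a \<in> closed_pos_cone C \<inter> cball 0 1 \<and>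
                                      b \<in> closed_pos_cone D \<inter> cball 0 1}"

end

theory Submission
  imports Defs
begin

text \<open>
  Put \<open>\<sigma> = \<langle>x, y\<rangle>\<close>, \<open>K = closed_pos_cone C\<close> and \<open>w = y - \<sigma>x\<close>. Everything follows from
  \<open>\<langle>x, w\<rangle> = 0\<close> and \<open>\<langle>z, w\<rangle> \<le> 0\<close> for \<open>z \<in> K\<close>. By homogeneity
  \<open>\<langle>a, y\<rangle> \<le> \<sigma> \<parallel>a\<parallel> \<parallel>y\<parallel>\<close> on \<open>K\<close>, so either \<open>\<sigma> = 0\<close>, where the two relations are immediate, or
  \<open>\<parallel>x\<parallel> = \<parallel>y\<parallel> = 1\<close>. In the latter case \<open>x\<close> maximizes \<open>\<langle>a, y\<rangle> - \<sigma> \<parallel>a\<parallel>\<close> over the convex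
  cone \<open>K\<close>, and the first-order condition in the direction \<open>z\<close> is \<open>\<langle>z, y\<rangle> \<le> \<sigma> \<langle>z, x\<rangle>\<close>.
\<close>

section \<open>Positive cones, their closed hulls and polar cones\<close>

lemma is_pos_cone_iff: "is_pos_cone A \<longleftrightarrow> (\<forall>\<mu>>0. \<forall>a\<in>A. \<mu> *\<^sub>R a \<in> A)"
proof
  assume "is_pos_cone A"
  then show "\<forall>\<mu>>0. \<forall>a\<in>A. \<mu> *\<^sub>R a \<in> A"
    unfolding is_pos_cone_def pos_cone_def by blast
next
  assume "\<forall>\<mu>>0. \<forall>a\<in>A. \<mu> *\<^sub>R a \<in> A"
  moreover have "a \<in> pos_cone A" if "a \<in> A" for a
    unfolding pos_cone_def using that by (force intro: exI[of _ 1])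
  ultimately show "is_pos_cone A"
    unfolding is_pos_cone_def pos_cone_def by blast
qed

lemma is_pos_cone_pos_cone: "is_pos_cone (pos_cone A)"
  unfolding is_pos_cone_iff pos_cone_def by (force intro: mult_pos_pos)

lemma subset_pos_cone: "A \<subseteq> pos_cone A"
  unfolding pos_cone_def by (force intro: exI[of _ 1])

lemma convex_pos_cone:
  assumes "convex A"
  shows "convex (pos_cone A)"
proof (rule convexI)
  fix p q and u v :: real
  assume "p \<in> pos_cone A" "q \<in> pos_cone A" and uv: "0 \<le> u" "0 \<le> v" "u + v = 1"
  then obtain \<mu> a \<nu> b where p: "p = \<mu> *\<^sub>R a" "\<mu> > 0" "a \<in> A" and q: "q = \<nu> *\<^sub>R b" "\<nu> > 0" "b \<in> A"
    unfolding pos_cone_def by blast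
  \<comment> \<open>The total weight carried by a and b; dividing by it leaves a convex combination
    of points of A.\<close>
  define r where "r = u * \<mu> + v * \<nu>"
  have r: "r > 0"
    using uv p q unfolding r_def
    by (metis add_cancel_left_left add_nonneg_pos add_pos_nonneg less_eq_real_def mult_nonneg_nonneg mult_pos_pos
        zero_less_one)
  have "(u * \<mu> / r) *\<^sub>R a + (v * \<nu> / r) *\<^sub>R b \<in> A"
    using assms p q uv r by (intro convexD) (auto simp: r_def simp flip: add_divide_distrib)
  moreover have "u *\<^sub>R p + v *\<^sub>R q = r *\<^sub>R ((u * \<mu> / r) *\<^sub>R a + (v * \<nu> / r) *\<^sub>R b)"
    using r p q by (simp add: scaleR_add_right)
  ultimately show "u *\<^sub>R p + v *\<^sub>R q \<in> pos_cone A"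
    using r unfolding pos_cone_def by blast
qed

lemma is_pos_cone_closure:
  fixes A :: "'a::real_normed_vector set"
  assumes "is_pos_cone A"
  shows "is_pos_cone (closure A)"
  unfolding is_pos_cone_iff
proof (intro allI impI ballI)
  fix \<mu> :: real and a assume "\<mu> > 0" "a \<in> closure A"
  then have "\<mu> *\<^sub>R a \<in> closure ((*\<^sub>R) \<mu> ` A)"
    by (simp add: closure_scaleR[symmetric])
  moreover have "(*\<^sub>R) \<mu> ` A \<subseteq> A"
    using assms \<open>\<mu> > 0\<close> unfolding is_pos_cone_iff by blast
  ultimately show "\<mu> *\<^sub>R a \<in> closure A"
    using closure_mono by blast
qed

lemma closed_pos_cone_minimal:
  assumes "A \<subseteq> S" "closed S" "is_pos_cone S"
  shows "closed_pos_cone A \<subseteq> S"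
  unfolding closed_pos_cone_def using assms by (simp add: hull_minimal)

lemma subset_closed_pos_cone: "A \<subseteq> closed_pos_cone A"
  unfolding closed_pos_cone_def by (rule hull_subset)

lemma scaleR_closed_pos_cone:
  "a \<in> closed_pos_cone A \<Longrightarrow> \<mu> > 0 \<Longrightarrow> \<mu> *\<^sub>R a \<in> closed_pos_cone A"
  unfolding closed_pos_cone_def hull_def is_pos_cone_iff by auto

text \<open>Makes the abstract hull concrete, so that convexity passes from A to it. The closure of
  a cone is again a cone, and a closed cone around A absorbs first \<open>pos_cone A\<close>, then
  its limits.\<close>

lemma closed_pos_cone_eq_closure: "closed_pos_cone A = closure (pos_cone A)"
proof
  show "closed_pos_cone A \<subseteq> closure (pos_cone A)"
    using subset_pos_cone closure_subset
    by (intro closed_pos_cone_minimal is_pos_cone_closure is_pos_cone_pos_cone) (blast, simp)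
  have "pos_cone A \<subseteq> closed_pos_cone A"
    unfolding pos_cone_def using scaleR_closed_pos_cone subset_closed_pos_cone by blast
  moreover have "closed (closed_pos_cone A)"
    unfolding closed_pos_cone_def hull_def by auto
  ultimately show "closure (pos_cone A) \<subseteq> closed_pos_cone A"
    by (simp add: closure_minimal)
qed

lemma add_closed_pos_cone:
  assumes "convex A" "a \<in> closed_pos_cone A" "b \<in> closed_pos_cone A"
  shows "a + b \<in> closed_pos_cone A"
proof -
  have "convex (closed_pos_cone A)"
    by (simp add: closed_pos_cone_eq_closure assms convex_closure convex_pos_cone)
  \<comment> \<open>The sum is twice the midpoint, which convexity keeps in the cone.\<close>
  then have "(1/2) *\<^sub>R a + (1/2) *\<^sub>R b \<in> closed_pos_cone A"
    using assms by (intro convexD) auto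
  from scaleR_closed_pos_cone[OF this, of 2] show ?thesis
    by (simp add: scaleR_add_right)
qed

text \<open>For fixed u, the z with \<open>inner z u \<le> 0\<close> form a closed cone, which
  therefore contains the hull as soon as it contains A.\<close>

lemma polar_cone_closed_pos_cone: "polar_cone (closed_pos_cone A) = polar_cone A"
proof
  show "polar_cone (closed_pos_cone A) \<subseteq> polar_cone A"
    unfolding polar_cone_def using subset_closed_pos_cone by blast
  show "polar_cone A \<subseteq> polar_cone (closed_pos_cone A)"
  proof
    fix u assume "u \<in> polar_cone A"
    moreover have "closed {z. inner z u \<le> 0}"
      by (intro closed_Collect_le continuous_intros)
    ultimately have "closed_pos_cone A \<subseteq> {z. inner z u \<le> 0}"
      by (intro closed_pos_cone_minimal) (auto simp: polar_cone_def is_pos_cone_iff mult_le_0_iff)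
    then show "u \<in> polar_cone (closed_pos_cone A)"
      unfolding polar_cone_def by blast
  qed
qed

text \<open>An obtuse angle at p turns the expansion of the squared distance from z to a into a
  Pythagorean inequality. It gives minimality of p and, through its extra term, uniqueness, which
  the definite description requires.\<close>

lemma projector_eqI:
  assumes "p \<in> A" and obtuse: "\<And>a. a \<in> A \<Longrightarrow> inner (a - p) (z - p) \<le> 0"
  shows "projector A z = p"
proof -
  have pythagoras: "(dist z p)\<^sup>2 + (dist p a)\<^sup>2 \<le> (dist z a)\<^sup>2" if "a \<in> A" for a
    using obtuse[OF that]
    by (simp add: dist_norm power2_norm_eq_inner inner_diff inner_commute)
  show ?thesis
    unfolding projector_def
  proof (rule the_equality)
    show "p \<in> A \<and> (\<forall>a\<in>A. dist z p \<le> dist z a)"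
      using \<open>p \<in> A\<close> pythagoras
      by (meson add_increasing2 dual_order.trans le_add_same_cancel1 power2_le_imp_le zero_le_dist zero_le_power2)
  next
    fix q assume q: "q \<in> A \<and> (\<forall>a\<in>A. dist z q \<le> dist z a)"
    then have "(dist z q)\<^sup>2 \<le> (dist z p)\<^sup>2"
      using \<open>p \<in> A\<close> by (intro power_mono) auto
    with pythagoras[of q] q have "(dist p q)\<^sup>2 \<le> 0" by linarith
    then show "q = p" by simp
  qed
qed

section \<open>Principal vectors and the residual\<close>

lemma principal_vectors_commute:
  assumes "principal_vectors C D x y"
  shows "principal_vectors D C y x"
proof -
  have "{inner a b | a b. a \<in> closed_pos_cone C \<inter> cball 0 1 \<and> b \<in> closed_pos_cone D \<inter> cball 0 1}
      = {inner a b | a b. a \<in> closed_pos_cone D \<inter> cball 0 1 \<and> b \<in> closed_pos_cone C \<inter> cball 0 1}"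
    by (metis (no_types, opaque_lifting) inner_commute)
  with assms show ?thesis
    unfolding principal_vectors_def by (simp add: inner_commute)
qed

lemma principal_vectors_upper:
  fixes C D :: "'a::real_inner set"
  assumes "principal_vectors C D x y"
    and "a \<in> closed_pos_cone C" "norm a \<le> 1" "b \<in> closed_pos_cone D" "norm b \<le> 1"
  shows "inner a b \<le> inner x y"
proof -
  let ?S = "{inner a b | a b. a \<in> closed_pos_cone C \<inter> cball 0 1 \<and> b \<in> closed_pos_cone D \<inter> cball 0 1}"
  \<comment> \<open>\<open>Sup\<close> dominates the elements of a real set only once the set is
    bounded above; Cauchy-Schwarz supplies the bound 1.\<close>
  have "bdd_above ?S"
  proof (rule bdd_aboveI)
    fix s assume "s \<in> ?S"
    then obtain a b :: 'a where "s = inner a b" "norm a \<le> 1" "norm b \<le> 1" by auto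
    then show "s \<le> 1"
      by (metis mult_le_one norm_cauchy_schwarz norm_ge_zero order_trans)
  qed
  moreover have "inner a b \<in> ?S"
    using assms by auto
  ultimately show ?thesis
    using assms(1) unfolding principal_vectors_def by (simp add: cSup_upper)
qed

lemma principal_vectors_inner_le:
  assumes "principal_vectors C D x y"
    and "a \<in> closed_pos_cone C" "b \<in> closed_pos_cone D"
  shows "inner a b \<le> inner x y * (norm a * norm b)"
proof (cases "a = 0 \<or> b = 0")
  case False
  \<comment> \<open>Nonzero vectors are normalized by a positive factor, so they stay in their cones
    and enter the unit ball.\<close>
  have "sgn a \<in> closed_pos_cone C" "sgn b \<in> closed_pos_cone D"
    using assms(2,3) False by (simp_all add: sgn_div_norm scaleR_closed_pos_cone)
  then have "inner (sgn a) (sgn b) \<le> inner x y"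
    by (intro principal_vectors_upper[OF assms(1)]) (simp_all add: norm_sgn)
  with False show ?thesis
    by (simp add: sgn_div_norm field_simps)
qed auto

lemma principal_vectors_zero_or_unit:
  assumes "principal_vectors C D x y"
  shows "inner x y = 0 \<or> (inner x y > 0 \<and> norm x = 1 \<and> norm y = 1)"
proof -
  have mem: "x \<in> closed_pos_cone C" "y \<in> closed_pos_cone D" and le: "norm x \<le> 1" "norm y \<le> 1"
    using assms unfolding principal_vectors_def by auto
  \<comment> \<open>The homogeneous bound at the maximizing pair itself: a positive value forces the
    product of the norms to be at least 1.\<close>
  have max: "inner x y \<le> inner x y * (norm x * norm y)"
    using principal_vectors_inner_le[OF assms mem] .
  have prod_le: "norm x * norm y \<le> norm x" "norm x * norm y \<le> norm y"
    using le by (simp_all add: mult_left_le mult_left_le_one_le)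
  have "inner x y \<ge> 0"
  proof -
    \<comment> \<open>Halving x gives another admissible pair, with half the value; the maximum is
      at least its own half, hence nonnegative.\<close>
    have "inner ((1/2) *\<^sub>R x) y \<le> inner x y"
      using mem le by (intro principal_vectors_upper[OF assms]) (simp_all add: scaleR_closed_pos_cone)
    then show ?thesis by simp
  qed
  moreover have "norm x = 1 \<and> norm y = 1" if "inner x y > 0"
    using that max prod_le le by (simp add: mult_le_cancel_left1)
  ultimately show ?thesis by linarith
qed

text \<open>With \<sigma> = \<open>inner x y\<close>, the inner product is \<sigma> times 1 minus
  the squared norm of x; one of the two factors vanishes.\<close>

lemma principal_vectors_residual_orthogonal:
  assumes "principal_vectors C D x y"
  shows "inner x (y - inner x y *\<^sub>R x) = 0"
  using principal_vectors_zero_or_unit[OF assms]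
  by (auto simp: inner_diff_right dot_square_norm)

lemma principal_vectors_residual_polar:
  assumes pv: "principal_vectors C D x y" and "convex C"
  shows "y - inner x y *\<^sub>R x \<in> polar_cone (closed_pos_cone C)"
  unfolding polar_cone_def
proof (intro CollectI ballI)
  fix z assume z: "z \<in> closed_pos_cone C"
  define \<sigma> where "\<sigma> = inner x y"
  have mem: "x \<in> closed_pos_cone C" "y \<in> closed_pos_cone D"
    using pv unfolding principal_vectors_def by auto
  from principal_vectors_zero_or_unit[OF pv] have "inner z y \<le> \<sigma> * inner z x"
  proof
    assume "inner x y = 0"
    then show ?thesis
      using principal_vectors_inner_le[OF pv z mem(2)] unfolding \<sigma>_def by simp
  next
    assume unit: "inner x y > 0 \<and> norm x = 1 \<and> norm y = 1"
    \<comment> \<open>Moving from x to x + tz stays in the cone. The constant terms cancel because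
      \<sigma> is \<open>inner x y\<close>, and division by t leaves an error linear in t.\<close>
    have first_order: "inner z y \<le> \<sigma> * inner z x + t * (\<sigma> * (norm z)\<^sup>2 / 2)" if "t > 0" for t
    proof -
      let ?n = "norm (x + t *\<^sub>R z)"
      have "x + t *\<^sub>R z \<in> closed_pos_cone C"
        using \<open>convex C\<close> mem z that by (intro add_closed_pos_cone scaleR_closed_pos_cone)
      then have "inner (x + t *\<^sub>R z) y \<le> \<sigma> * ?n"
        using principal_vectors_inner_le[OF pv _ mem(2)] unit unfolding \<sigma>_def by force
      \<comment> \<open>This replaces the norm by a quadratic tangent to it at the value 1, attained
        at t = 0, so the first-order term in t is unchanged.\<close>
      also have "?n \<le> (1 + ?n\<^sup>2) / 2"
        using zero_le_power2[of "?n - 1"] by (simp add: power2_eq_square algebra_simps)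
      also have "?n\<^sup>2 = 1 + 2 * t * inner z x + t\<^sup>2 * (norm z)\<^sup>2"
        using unit by (simp add: power2_norm_eq_inner norm_eq_1 inner_simps inner_commute)
          (simp add: power2_eq_square algebra_simps)
      finally have "inner (x + t *\<^sub>R z) y \<le> \<sigma> * ((1 + (1 + 2 * t * inner z x + t\<^sup>2 * (norm z)\<^sup>2)) / 2)"
        using unit by (simp add: \<sigma>_def)
      then have "t * inner z y \<le> t * (\<sigma> * inner z x + t * (\<sigma> * (norm z)\<^sup>2 / 2))"
        by (simp add: inner_simps \<sigma>_def[symmetric] power2_eq_square field_simps)
      with that show ?thesis by (simp only: mult_le_cancel_left_pos)
    qed
    \<comment> \<open>Letting t tend to 0 from the right removes the error term.\<close>
    have "((\<lambda>t. \<sigma> * inner z x + t * (\<sigma> * (norm z)\<^sup>2 / 2)) \<longlongrightarrow>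
        \<sigma> * inner z x + 0 * (\<sigma> * (norm z)\<^sup>2 / 2)) (at_right 0)"
      by (intro tendsto_intros)
    then show ?thesis
      using first_order
      by (intro tendsto_lowerbound[of _ _ "at_right 0"])
        (auto simp: eventually_at_filter intro: always_eventually)
  qed
  then show "inner z (y - inner x y *\<^sub>R x) \<le> 0"
    by (simp add: inner_diff_right \<sigma>_def)
qed

lemma principal_vectors_residual_nonzero:
  assumes "principal_vectors C D x y" "y \<noteq> 0" "\<bar>inner x y\<bar> \<noteq> 1"
  shows "y - inner x y *\<^sub>R x \<noteq> 0"
proof
  assume "y - inner x y *\<^sub>R x = 0"
  then have y: "y = inner x y *\<^sub>R x" by simp
  with assms(2) have "inner x y \<noteq> 0" by force
  \<comment> \<open>A nonzero value makes both vectors unit; taking norms in y = \<sigma>x then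
    gives |\<sigma>| = 1.\<close>
  then have "norm x = 1" "norm y = 1"
    using principal_vectors_zero_or_unit[OF assms(1)] by auto
  with y assms(3) show False
    by (metis mult.right_neutral norm_scaleR)
qed

section \<open>Rays leaving the closed cone\<close>

lemma translated_ray_disjoint_closed_pos_cone:
  assumes "w \<in> polar_cone (closed_pos_cone C)" "inner x w = 0" "w \<noteq> 0" "\<mu> > 0"
  shows "x + \<mu> *\<^sub>R w \<notin> closed_pos_cone C"
proof
  assume "x + \<mu> *\<^sub>R w \<in> closed_pos_cone C"
  with assms(1) have "inner (x + \<mu> *\<^sub>R w) w \<le> 0"
    unfolding polar_cone_def by blast
  \<comment> \<open>By orthogonality this inner product is \<mu> times the squared norm of w, hence
    positive.\<close>
  with assms(2-4) show False
    by (simp add: inner_add_left mult_le_0_iff flip: power2_norm_eq_inner)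
qed

lemma notin_interior_if_ray_outside:
  fixes x w :: "'a::real_normed_vector"
  assumes "\<And>\<mu>. \<mu> > 0 \<Longrightarrow> x + \<mu> *\<^sub>R w \<notin> S"
  shows "x \<notin> interior S"
proof
  assume "x \<in> interior S"
  \<comment> \<open>The ray tends to its endpoint x, so it would eventually enter the open
    interior.\<close>
  moreover have "((\<lambda>\<mu>. x + \<mu> *\<^sub>R w) \<longlongrightarrow> x + 0 *\<^sub>R w) (at_right 0)"
    by (intro tendsto_intros)
  ultimately have "eventually (\<lambda>\<mu>. x + \<mu> *\<^sub>R w \<in> interior S) (at_right 0)"
    by (intro topological_tendstoD) auto
  moreover have "eventually (\<lambda>\<mu>::real. \<mu> > 0) (at_right 0)"
    by (rule eventually_at_right_less)
  ultimately have "eventually (\<lambda>\<mu>::real. False) (at_right 0)"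
    by eventually_elim (use assms interior_subset in blast)
  then show False by simp
qed

text \<open>The half of the claims that concerns C; swapping the pair gives the other half. Since x
  lies in the closed cone, w in its polar, and the two are orthogonal, x + lam w is a Moreau
  decomposition, and both projections can be read off.\<close>

lemma principal_vectors_one_sided:
  assumes pv: "principal_vectors C D x y" and "convex C"
  defines "w \<equiv> y - inner x y *\<^sub>R x"
  shows "y \<noteq> 0 \<Longrightarrow> \<bar>inner x y\<bar> \<noteq> 1 \<Longrightarrow> (+) x ` pos_cone {w} \<subseteq> - closed_pos_cone C"
    and "y \<noteq> 0 \<Longrightarrow> \<bar>inner x y\<bar> \<noteq> 1 \<Longrightarrow> x \<notin> interior (closed_pos_cone C)"
    and "\<forall>s \<in> (+) x ` pos_cone {w}. projector (closed_pos_cone C) s = x"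
    and "lam > 0 \<Longrightarrow> lam *\<^sub>R w = projector (polar_cone C) (x + lam *\<^sub>R w)"
proof -
  have x: "x \<in> closed_pos_cone C"
    using pv unfolding principal_vectors_def by auto
  have orth: "inner x w = 0"
    unfolding w_def by (rule principal_vectors_residual_orthogonal[OF pv])
  have polar: "w \<in> polar_cone (closed_pos_cone C)"
    unfolding w_def by (rule principal_vectors_residual_polar[OF pv \<open>convex C\<close>])
  have outside: "x + \<mu> *\<^sub>R w \<notin> closed_pos_cone C" if "y \<noteq> 0" "\<bar>inner x y\<bar> \<noteq> 1" "\<mu> > 0" for \<mu>
    using translated_ray_disjoint_closed_pos_cone[OF polar orth _ that(3)]
      principal_vectors_residual_nonzero[OF pv that(1,2)] unfolding w_def by blast
  show "(+) x ` pos_cone {w} \<subseteq> - closed_pos_cone C" if "y \<noteq> 0" "\<bar>inner x y\<bar> \<noteq> 1"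
    using outside[OF that] unfolding pos_cone_def by auto
  show "x \<notin> interior (closed_pos_cone C)" if "y \<noteq> 0" "\<bar>inner x y\<bar> \<noteq> 1"
    using outside[OF that] by (rule notin_interior_if_ray_outside)
  show "\<forall>s \<in> (+) x ` pos_cone {w}. projector (closed_pos_cone C) s = x"
  proof
    fix s assume "s \<in> (+) x ` pos_cone {w}"
    then obtain \<mu> where s: "s = x + \<mu> *\<^sub>R w" "\<mu> > 0"
      unfolding pos_cone_def by auto
    show "projector (closed_pos_cone C) s = x"
    proof (rule projector_eqI[OF x])
      fix a assume "a \<in> closed_pos_cone C"
      with polar have "inner a w \<le> 0"
        unfolding polar_cone_def by blast
      with s orth show "inner (a - x) (s - x) \<le> 0"
        by (simp add: inner_diff_left mult_le_0_iff)
    qed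
  qed
  show "lam *\<^sub>R w = projector (polar_cone C) (x + lam *\<^sub>R w)" if "lam > 0"
  proof (rule projector_eqI[symmetric])
    show "lam *\<^sub>R w \<in> polar_cone C"
      using polar that unfolding polar_cone_closed_pos_cone
      by (simp add: polar_cone_def mult_le_0_iff)
  next
    fix v assume "v \<in> polar_cone C"
    then have "inner x v \<le> 0"
      using x unfolding polar_cone_closed_pos_cone[of C, symmetric] by (simp add: polar_cone_def)
    \<comment> \<open>The difference of the projected point and lam w is x, so the obtuse-angle
      condition reduces to \<open>inner v x \<le> 0\<close>.\<close>
    with orth show "inner (v - lam *\<^sub>R w) (x + lam *\<^sub>R w - lam *\<^sub>R w) \<le> 0"
      by (simp add: inner_diff_left inner_diff_right inner_commute)
  qed
qed

theorem proposition3p8: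
  fixes C D :: "'a::{real_inner, complete_space} set"
    and x y :: 'a and lam :: real
  assumes "(UNIV :: 'a set) \<noteq> {0}"
    and "C \<noteq> {}" and "convex C" and "C \<noteq> {0}"
    and "D \<noteq> {}" and "convex D" and "D \<noteq> {0}"
    and "principal_vectors C D x y"
    and "lam > 0"
  shows
    "(x \<noteq> 0 \<and> y \<noteq> 0 \<and> \<bar>inner x y\<bar> \<noteq> 1 \<longrightarrow>
        (+) x ` pos_cone {y - inner x y *\<^sub>R x} \<subseteq> - closed_pos_cone C \<and>
        x \<notin> interior (closed_pos_cone C) \<and>
        (+) y ` pos_cone {x - inner x y *\<^sub>R y} \<subseteq> - closed_pos_cone D \<and>
        y \<notin> interior (closed_pos_cone D)) \<and>
     ((\<forall>s \<in> (+) x ` pos_cone {y - inner x y *\<^sub>R x}. projector (closed_pos_cone C) s = x) \<and>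
      (\<forall>s \<in> (+) y ` pos_cone {x - inner x y *\<^sub>R y}. projector (closed_pos_cone D) s = y)) \<and>
     (lam *\<^sub>R (y - inner x y *\<^sub>R x)
        = projector (polar_cone C) (x + lam *\<^sub>R (y - inner x y *\<^sub>R x)) \<and>
      lam *\<^sub>R (x - inner x y *\<^sub>R y)
        = projector (polar_cone D) (y + lam *\<^sub>R (x - inner x y *\<^sub>R y)))"
proof -
  note C = principal_vectors_one_sided[OF assms(8,3)]
  \<comment> \<open>Swapping the pair produces \<open>inner y x\<close>; the unfolding restores the
    form \<open>inner x y\<close> of the goal.\<close>
  note D = principal_vectors_one_sided[OF principal_vectors_commute[OF assms(8)] assms(6),
      unfolded inner_commute[of y x]]
  show ?thesis
    using C(1,2,3) C(4)[OF assms(9)] D(1,2,3) D(4)[OF assms(9)] by blast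
qed

end
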